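(* Let $r>0$, $\phi(v)=r|v|$ and $f(x)=\frac12x^2$ on $\mathbb R$, and consider the system $$\ddot x(t)+2\dot x(t)+\partial\phi(\dot x(t))+f'(x(t))\ni0,\quad t\ge0,\qquad x(0)=x_0,\ \dot x(0)=v_0.$$ For every $A>0$, the (unique global strong) solution starting from $x_0=-r-A$ and $v_0=A$ is $$x(t)=-r-Ae^{-t},\qquad v(t)=\dot x(t)=Ae^{-t}.$$ It converges as $t\to+\infty$ to the boundary equilibrium $x_\infty=-r$ (i.e. $-f'(x_\infty)$ lies on the boundary of $\partial\phi(0)=[-r,r]$), but it never stops in finite time: there is no $T\geq 0$ with $v(t)=0$ for all $t\ge T$.
   Context: $\partial\phi$ is the convex subdifferential. A strong solution on $[0,T]$ is a pair $(x,v)$ with $x,v\in W^{1,2}(0,T)$, $v=\dot x$ a.e., the given initial values, and some $\xi\in L^2(0,T)$ with $\xi(t)\in\partial\phi(v(t))$ and $\dot v(t)+2v(t)+\xi(t)+f'(x(t))=0$ for a.e. $t\in(0,T)$; a global strong solution is one whose restriction to every $[0,T]$ is a strong solution. *)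

theory Defs
  imports "HOL-Analysis.Analysis"
begin

definition subdifferential :: "('a::real_inner \<Rightarrow> real) \<Rightarrow> 'a \<Rightarrow> 'a set" where
  "subdifferential \<phi> v = {\<xi>. \<forall>w. \<phi> v + \<xi> \<bullet> (w - v) \<le> \<phi> w}"

definition L2_on :: "real \<Rightarrow> real \<Rightarrow> (real \<Rightarrow> real) \<Rightarrow> bool" where
  "L2_on a b u \<longleftrightarrow>
     set_borel_measurable lebesgue {a<..<b} u \<and>
     set_integrable lebesgue {a<..<b} (\<lambda>t. (u t)\<^sup>2)"

definition test_function :: "real \<Rightarrow> real \<Rightarrow> (real \<Rightarrow> real) \<Rightarrow> bool" where
  "test_function a b \<psi> \<longleftrightarrow>
     \<psi> C1_differentiable_on UNIV \<and>
     compact (closure {t. \<psi> t \<noteq> 0}) \<and> closure {t. \<psi> t \<noteq> 0} \<subseteq> {a<..<b}"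

definition weak_derivative :: "real \<Rightarrow> real \<Rightarrow> (real \<Rightarrow> real) \<Rightarrow> (real \<Rightarrow> real) \<Rightarrow> bool" where
  "weak_derivative a b u g \<longleftrightarrow>
     (\<forall>\<psi>. test_function a b \<psi> \<longrightarrow>
        (LINT t:{a<..<b}|lebesgue. u t * deriv \<psi> t) =
        - (LINT t:{a<..<b}|lebesgue. g t * \<psi> t))"

text \<open>\<open>W12_deriv a b u g\<close>: \<open>u\<close> belongs to the Sobolev space \<open>W\<^sup>1\<^sup>,\<^sup>2(a, b)\<close> and \<open>g\<close> is (a
  representative of) its derivative.\<close>

definition W12_deriv :: "real \<Rightarrow> real \<Rightarrow> (real \<Rightarrow> real) \<Rightarrow> (real \<Rightarrow> real) \<Rightarrow> bool" where
  "W12_deriv a b u g \<longleftrightarrow> L2_on a b u \<and> L2_on a b g \<and> weak_derivative a b u g"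

text \<open>Elements of \<open>W\<^sup>1\<^sup>,\<^sup>2(0, T)\<close> are identified with their continuous representatives on
  \<open>[0, T]\<close>, which gives the initial conditions their meaning.\<close>

definition strong_solution ::
  "(real \<Rightarrow> real) \<Rightarrow> (real \<Rightarrow> real) \<Rightarrow> real \<Rightarrow> real \<Rightarrow> real \<Rightarrow> (real \<Rightarrow> real) \<Rightarrow> (real \<Rightarrow> real) \<Rightarrow> bool"
where
  "strong_solution \<phi> f x0 v0 T x v \<longleftrightarrow>
     continuous_on {0..T} x \<and> continuous_on {0..T} v \<and>
     x 0 = x0 \<and> v 0 = v0 \<and>
     (\<exists>x' v' \<xi>. W12_deriv 0 T x x' \<and> W12_deriv 0 T v v' \<and> L2_on 0 T \<xi> \<and>
        (AE t in lebesgue. t \<in> {0<..<T} \<longrightarrow> v t = x' t) \<and>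
        (AE t in lebesgue. t \<in> {0<..<T} \<longrightarrow>
           \<xi> t \<in> subdifferential \<phi> (v t) \<and>
           v' t + 2 * v t + \<xi> t + deriv f (x t) = 0))"

text \<open>Only the values on \<open>[0, \<infinity>)\<close> matter.\<close>

definition global_strong_solution ::
  "(real \<Rightarrow> real) \<Rightarrow> (real \<Rightarrow> real) \<Rightarrow> real \<Rightarrow> real \<Rightarrow> (real \<Rightarrow> real) \<Rightarrow> (real \<Rightarrow> real) \<Rightarrow> bool"
where
  "global_strong_solution \<phi> f x0 v0 x v \<longleftrightarrow> (\<forall>T>0. strong_solution \<phi> f x0 v0 T x v)"

end

theory Submission
  imports Defs
begin

text \<open>A continuous function with an integrable weak derivative is the integral of that
  derivative, as one sees by testing with \<open>C\<^sup>1\<close> approximations of the indicator function of an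
  interval. For two strong solutions with velocity difference \<open>u\<close> and position difference \<open>z\<close>,
  monotonicity of \<open>\<partial>\<phi>\<close> makes \<open>u'\<close> at most \<open>L\<bar>z\<bar>\<close> wherever \<open>u > 0\<close>, and symmetrically where
  \<open>u < 0\<close>; integrating from the last zero of \<open>u\<close> gives \<open>\<bar>u(t)\<bar> \<le> L \<integral>\<^sub>0\<^sup>t \<bar>z\<bar>\<close>, and Gronwall's
  lemma yields uniqueness. This avoids a product rule for absolutely continuous functions.
  Existence is a computation with \<open>\<xi> = r\<close>.\<close>

section \<open>Piecewise quadratic cut-offs and an approximate identity\<close>

text \<open>The two branches meet at 0 with common slope 0, so the squared positive part is C1.
  Since test functions are only required to be C1, shifted copies of it suffice to build
  them.\<close>

lemma has_real_derivative_max_power2: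
  "((\<lambda>x::real. (max 0 x)\<^sup>2) has_real_derivative 2 * max 0 x) (at x)"
proof -
  consider "x < 0" | "x > 0" | "x = 0" by linarith
  then show ?thesis
  proof cases
    case 1
    have "((\<lambda>x::real. 0) has_real_derivative 2 * max 0 x) (at x)"
      using 1 by simp
    moreover have "\<forall>\<^sub>F y in nhds x. (max 0 y)\<^sup>2 = 0"
      using 1 by (intro eventually_nhds_in_open[of "{..<0}", THEN eventually_mono]) auto
    ultimately show ?thesis
      by (subst DERIV_cong_ev[OF refl _ refl])
  next
    case 2
    have "((\<lambda>x::real. x\<^sup>2) has_real_derivative 2 * max 0 x) (at x)"
      using 2 by (auto intro!: derivative_eq_intros)
    moreover have "\<forall>\<^sub>F y in nhds x. (max 0 y)\<^sup>2 = y\<^sup>2"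
      using 2 by (intro eventually_nhds_in_open[of "{0<..}", THEN eventually_mono]) auto
    ultimately show ?thesis
      by (subst DERIV_cong_ev[OF refl _ refl])
  next
    case 3
    have "((\<lambda>h::real. max 0 h) \<longlongrightarrow> 0) (at 0)"
      by (rule tendsto_eq_intros | simp)+
    then have "((\<lambda>h::real. (max 0 h)\<^sup>2 / h) \<longlongrightarrow> 0) (at 0)"
      by (rule Lim_transform_eventually)
        (auto simp: eventually_at_filter max_def power2_eq_square)
    then show ?thesis
      using 3 by (simp add: DERIV_def)
  qed
qed

text \<open>\<open>hat\<close> is the triangular bump on \<open>[0, 1]\<close> of mass 1, and \<open>smooth_step\<close> its primitive.\<close>

definition hat :: "real \<Rightarrow> real" where
  "hat x = 4 * max 0 x - 8 * max 0 (x - 1/2) + 4 * max 0 (x - 1)"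

definition smooth_step :: "real \<Rightarrow> real" where
  "smooth_step x = 2 * (max 0 x)\<^sup>2 - 4 * (max 0 (x - 1/2))\<^sup>2 + 2 * (max 0 (x - 1))\<^sup>2"

lemma hat_nonneg: "hat x \<ge> 0"
  by (auto simp: hat_def max_def)

lemma hat_eq_0: "x \<le> 0 \<or> x \<ge> 1 \<Longrightarrow> hat x = 0"
  by (auto simp: hat_def max_def)

lemma continuous_on_hat [continuous_intros]:
  "continuous_on S f \<Longrightarrow> continuous_on S (\<lambda>x. hat (f x))"
  unfolding hat_def by (intro continuous_intros)

lemma has_real_derivative_smooth_step:
  "(smooth_step has_real_derivative hat x) (at x)"
proof -
  have shift: "((\<lambda>x::real. (max 0 (x - c))\<^sup>2) has_real_derivative 2 * max 0 (x - c)) (at x)" for c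
    by (rule DERIV_chain2[where f = "\<lambda>x. (max 0 x)\<^sup>2" and g = "\<lambda>x. x - c" and Db = 1, simplified])
      (auto intro!: derivative_eq_intros has_real_derivative_max_power2)
  show ?thesis
    unfolding smooth_step_def [abs_def] hat_def
    by (rule derivative_eq_intros shift has_real_derivative_max_power2 refl | simp)+
qed

lemma has_real_derivative_smooth_step_scaled:
  "((\<lambda>\<tau>. smooth_step (c * (\<tau> - s))) has_real_derivative c * hat (c * (\<tau> - s))) (at \<tau>)"
proof -
  have "((\<lambda>\<tau>. c * (\<tau> - s)) has_real_derivative c) (at \<tau>)"
    by (auto intro!: derivative_eq_intros)
  from DERIV_chain2[OF has_real_derivative_smooth_step this] show ?thesis
    by (simp add: mult.commute)
qed

lemma smooth_step_eq_0: "x \<le> 0 \<Longrightarrow> smooth_step x = 0"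
  by (auto simp: smooth_step_def)

lemma smooth_step_eq_1: "x \<ge> 1 \<Longrightarrow> smooth_step x = 1"
  by (auto simp: smooth_step_def power2_eq_square field_simps)

lemma mono_smooth_step: "x \<le> y \<Longrightarrow> smooth_step x \<le> smooth_step y"
  using has_real_derivative_smooth_step hat_nonneg
  by (meson DERIV_nonneg_imp_nondecreasing)

lemma smooth_step_bounds: "0 \<le> smooth_step x" "smooth_step x \<le> 1"
  using mono_smooth_step[of "min x 0" x] mono_smooth_step[of x "max x 1"]
  by (auto simp: smooth_step_eq_0 smooth_step_eq_1)

lemma continuous_on_smooth_step [continuous_intros]:
  "continuous_on S f \<Longrightarrow> continuous_on S (\<lambda>x. smooth_step (f x))"
  unfolding smooth_step_def by (intro continuous_intros)

text \<open>To the right of \<open>s\<close> the scaled argument eventually exceeds 1; at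
  \<open>s\<close> itself the value is 0 for every \<open>n\<close>, whence the open half-line in
  the limit.\<close>

lemma smooth_step_scaled_tendsto:
  "(\<lambda>n. smooth_step (real n * (\<tau> - s))) \<longlonglongrightarrow> indicat_real {s<..} \<tau>"
proof (cases "\<tau> > s")
  case True
  obtain N where N: "real N > 1 / (\<tau> - s)"
    using reals_Archimedean2 by blast
  have "smooth_step (real n * (\<tau> - s)) = 1" if "n \<ge> N" for n
  proof (rule smooth_step_eq_1)
    have "1 / (\<tau> - s) < real n" using N that by linarith
    then show "1 \<le> real n * (\<tau> - s)" using True by (simp add: field_simps)
  qed
  then show ?thesis
    using True by (intro tendsto_eventually) (auto simp: eventually_sequentially)
next
  case False
  then show ?thesis
    by (intro tendsto_eventually) (simp add: smooth_step_eq_0 mult_nonneg_nonpos)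
qed

text \<open>The kernel has mass 1 and lives on the one-sided interval from \<open>s\<close> to
  \<open>s + 1/n\<close>, where \<open>u\<close> is close to \<open>u s\<close> by
  continuity.\<close>

lemma hat_approximate_identity:
  fixes u :: "real \<Rightarrow> real"
  assumes u: "continuous_on {a..b} u" and s: "a < s" "s < b"
  shows "(\<lambda>n. integral {a..b} (\<lambda>\<tau>. u \<tau> * (real n * hat (real n * (\<tau> - s))))) \<longlonglongrightarrow> u s"
proof (rule LIMSEQ_I)
  fix e :: real assume e: "e > 0"
  have "isCont u s"
    using u s by (simp add: continuous_on_interior)
  then obtain d where d: "d > 0" "\<And>\<tau>. \<bar>\<tau> - s\<bar> < d \<Longrightarrow> \<bar>u \<tau> - u s\<bar> < e / 2"
    using e unfolding continuous_at_eps_delta dist_real_def by (meson half_gt_zero)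
  \<comment> \<open>Once \<open>1/n < m\<close>, the support of the kernel lies both inside the
    continuity window and to the left of \<open>b\<close>, so no mass is lost.\<close>
  define m where "m = min d (b - s)"
  have m: "m > 0" "m \<le> d" "m \<le> b - s" using d s by (auto simp: m_def)
  obtain N where N: "real N > 1 / m"
    using reals_Archimedean2 by blast
  have "norm (integral {a..b} (\<lambda>\<tau>. u \<tau> * (real n * hat (real n * (\<tau> - s)))) - u s) < e"
    if n: "n \<ge> N" for n
  proof -
    let ?h = "\<lambda>\<tau>. real n * hat (real n * (\<tau> - s))"
    have "1 / m < real n" using N n by linarith
    then have nm: "1 < real n * m" using m by (simp add: field_simps)
    then have "0 < real n" using m zero_less_mult_pos2[of "real n" m] by linarith
    have "(?h has_integral smooth_step (real n * (b - s)) - smooth_step (real n * (a - s))) {a..b}"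
      using s has_real_derivative_smooth_step_scaled[of "real n" s]
      by (intro fundamental_theorem_of_calculus)
        (auto simp: has_real_derivative_iff_has_vector_derivative[symmetric]
              intro: has_field_derivative_at_within)
    moreover have "real n * (b - s) \<ge> 1"
      using nm m mult_left_mono[OF m(3), of "real n"] by linarith
    ultimately have one: "(?h has_integral 1) {a..b}"
      using s by (simp add: smooth_step_eq_0 smooth_step_eq_1 mult_nonneg_nonpos)
    have int: "(\<lambda>\<tau>. u \<tau> * ?h \<tau>) integrable_on {a..b}"
      by (intro integrable_continuous_real continuous_intros u)
    have diff: "((\<lambda>\<tau>. u \<tau> * ?h \<tau> - u s * ?h \<tau>) has_integral
        integral {a..b} (\<lambda>\<tau>. u \<tau> * ?h \<tau>) - u s * 1) {a..b}"
      by (intro has_integral_diff has_integral_mult_right one integrable_integral int)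
    have "norm (u \<tau> * ?h \<tau> - u s * ?h \<tau>) \<le> e / 2 * ?h \<tau>" for \<tau>
    proof (cases "\<bar>\<tau> - s\<bar> < d")
      case True
      have "norm (u \<tau> * ?h \<tau> - u s * ?h \<tau>) = \<bar>u \<tau> - u s\<bar> * ?h \<tau>"
        by (simp add: abs_mult hat_nonneg flip: left_diff_distrib)
      also have "\<dots> \<le> e / 2 * ?h \<tau>"
        using d(2)[OF True] by (intro mult_right_mono) (auto simp: hat_nonneg)
      finally show ?thesis .
    next
      case False
      have "real n * (\<tau> - s) \<le> 0 \<or> real n * (\<tau> - s) \<ge> 1"
      proof (cases "\<tau> \<le> s")
        case True
        then show ?thesis by (simp add: mult_nonneg_nonpos)
      next
        case f: False
        then have "m \<le> \<tau> - s" using False m by linarith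
        then show ?thesis using nm mult_left_mono[of m "\<tau> - s" "real n"] by linarith
      qed
      then show ?thesis by (simp add: hat_eq_0)
    qed
    then have "norm (integral {a..b} (\<lambda>\<tau>. u \<tau> * ?h \<tau> - u s * ?h \<tau>)) \<le>
        integral {a..b} (\<lambda>\<tau>. e / 2 * ?h \<tau>)"
      using has_integral_integrable[OF diff] has_integral_mult_right[OF one, of "e / 2"]
      by (intro integral_norm_bound_integral) (auto simp: has_integral_iff)
    then show ?thesis
      using diff one e by (simp add: has_integral_iff)
  qed
  then show "\<exists>N. \<forall>n\<ge>N. norm (integral {a..b} (\<lambda>\<tau>. u \<tau> * (real n * hat (real n * (\<tau> - s)))) - u s) < e"
    by blast
qed

section \<open>From weak derivatives to the integral formula\<close>

text \<open>On a bounded interval \<open>1 + u^2\<close> is an integrable majorant of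
  \<open>\<bar>u\<bar>\<close>, and adding the endpoints changes nothing.\<close>

lemma L2_on_imp_absolutely_integrable:
  assumes "L2_on a b u"
  shows "u absolutely_integrable_on {a..b}"
proof -
  have m: "u \<in> borel_measurable (lebesgue_on {a<..<b})"
    using assms unfolding L2_on_def set_borel_measurable_def
    by (simp add: borel_measurable_restrict_space_iff)
  have "(\<lambda>t. (u t)\<^sup>2) integrable_on {a<..<b}"
    using assms set_lebesgue_integral_eq_integral(1) unfolding L2_on_def by blast
  then have "(\<lambda>t. 1 + (u t)\<^sup>2) integrable_on {a<..<b}"
    by (intro integrable_add)
      (auto intro: integrable_on_const simp: integrable_on_open_interval_real)
  moreover have "norm (u t) \<le> 1 + (u t)\<^sup>2" for t
    using zero_le_power2[of "\<bar>u t\<bar> - 1"] by (simp add: power2_eq_square algebra_simps)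
  ultimately have "u absolutely_integrable_on {a<..<b}"
    using m by (intro measurable_bounded_by_integrable_imp_absolutely_integrable) auto
  then show ?thesis
    by (simp add: absolutely_integrable_on_def integrable_on_open_interval_real)
qed

text \<open>Carries the defining identity from Lebesgue integrals over the open interval to gauge
  integrals over the closed one, where the fundamental theorem and dominated convergence are
  applied. Both integrands must be shown absolutely integrable for this transfer.\<close>

lemma weak_derivative_test:
  fixes u g \<psi> D :: "real \<Rightarrow> real"
  assumes w: "weak_derivative a b u g" and u: "continuous_on {a..b} u"
    and g: "g absolutely_integrable_on {a..b}"
    and \<psi>: "\<And>t. (\<psi> has_real_derivative D t) (at t)" and D: "continuous_on UNIV D"
    and supp: "{t. \<psi> t \<noteq> 0} \<subseteq> {c..d}" and cd: "a < c" "d < b"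
  shows "integral {a..b} (\<lambda>t. u t * D t) = - integral {a..b} (\<lambda>t. g t * \<psi> t)"
proof -
  have cl: "closure {t. \<psi> t \<noteq> 0} \<subseteq> {c..d}"
    by (intro closure_minimal supp) auto
  have "test_function a b \<psi>"
    unfolding test_function_def C1_differentiable_on_def
  proof (intro conjI exI[of _ D])
    show "\<forall>x\<in>UNIV. (\<psi> has_vector_derivative D x) (at x)"
      using \<psi> by (simp add: has_real_derivative_iff_has_vector_derivative)
    show "compact (closure {t. \<psi> t \<noteq> 0})"
      using cl by (meson bounded_closed_interval bounded_subset closed_closure compact_eq_bounded_closed)
  qed (use cl cd D in auto)
  moreover have "deriv \<psi> = D"
    using \<psi> DERIV_imp_deriv by blast
  ultimately have eq: "(LINT t:{a<..<b}|lebesgue. u t * D t) = - (LINT t:{a<..<b}|lebesgue. g t * \<psi> t)"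
    using w unfolding weak_derivative_def by auto
  have "(\<lambda>t. u t * D t) absolutely_integrable_on {a<..<b}"
    by (rule set_integrable_subset[OF absolutely_integrable_continuous_real[of a b]])
      (auto intro!: continuous_intros u continuous_on_subset[OF D])
  moreover have "(\<lambda>t. \<psi> t * g t) absolutely_integrable_on {a..b}"
  proof (rule absolutely_integrable_bounded_measurable_product_real)
    have "continuous_on {a..b} \<psi>"
      using \<psi> by (meson DERIV_isCont continuous_at_imp_continuous_on)
    then show "\<psi> \<in> borel_measurable (lebesgue_on {a..b})" "bounded (\<psi> ` {a..b})"
      by (auto intro: continuous_imp_measurable_on_sets_lebesgue compact_imp_bounded
            compact_continuous_image)
  qed (use g in auto)
  then have "(\<lambda>t. g t * \<psi> t) absolutely_integrable_on {a<..<b}"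
    by (subst mult.commute) (rule set_integrable_subset, auto)
  ultimately show ?thesis
    using eq by (simp add: set_lebesgue_integral_eq_integral integral_open_interval_real)
qed

text \<open>The test functions rise from 0 to 1 just after \<open>s\<close> and fall back just after
  \<open>t\<close>. Their derivatives approximate the difference of the point masses at
  \<open>s\<close> and \<open>t\<close>, while they themselves tend to the indicator of the interval
  between. Endpoints \<open>a\<close> and \<open>b\<close> are then reached by continuity.\<close>

lemma weak_derivative_FTC:
  fixes u g :: "real \<Rightarrow> real"
  assumes w: "weak_derivative a b u g" and u: "continuous_on {a..b} u"
    and g: "g absolutely_integrable_on {a..b}" and st: "a \<le> s" "s \<le> t" "t \<le> b"
  shows "(g has_integral u t - u s) {s..t}"
proof -
  have gi: "g integrable_on {a..b}"
    using g absolutely_integrable_on_def by blast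
  have interior: "integral {s..t} g = u t - u s" if st: "a < s" "s < t" "t < b" for s t
  proof -
    define \<psi> where "\<psi> n \<tau> = smooth_step (real n * (\<tau> - s)) - smooth_step (real n * (\<tau> - t))" for n \<tau>
    define D where "D n \<tau> = real n * hat (real n * (\<tau> - s)) - real n * hat (real n * (\<tau> - t))" for n \<tau>
    have \<psi>D: "(\<psi> n has_real_derivative D n \<tau>) (at \<tau>)" for n \<tau>
      unfolding \<psi>_def [abs_def] D_def
      by (intro DERIV_diff has_real_derivative_smooth_step_scaled)
    have D: "continuous_on UNIV (D n)" for n
      unfolding D_def [abs_def] by (intro continuous_intros)
    have "(\<lambda>n. integral {a..b} (\<lambda>\<tau>. u \<tau> * (real n * hat (real n * (\<tau> - s)))) -
        integral {a..b} (\<lambda>\<tau>. u \<tau> * (real n * hat (real n * (\<tau> - t))))) \<longlonglongrightarrow> u s - u t"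
      using st by (intro tendsto_diff hat_approximate_identity u) auto
    also have "(\<lambda>n. integral {a..b} (\<lambda>\<tau>. u \<tau> * (real n * hat (real n * (\<tau> - s)))) -
        integral {a..b} (\<lambda>\<tau>. u \<tau> * (real n * hat (real n * (\<tau> - t))))) =
        (\<lambda>n. integral {a..b} (\<lambda>\<tau>. u \<tau> * D n \<tau>))"
      unfolding D_def right_diff_distrib
      by (intro ext integral_diff [symmetric] integrable_continuous_real continuous_intros u)
    finally have lim1: "(\<lambda>n. integral {a..b} (\<lambda>\<tau>. u \<tau> * D n \<tau>)) \<longlonglongrightarrow> u s - u t" .
    have \<psi>i: "(\<lambda>\<tau>. g \<tau> * \<psi> n \<tau>) integrable_on {a..b}" for n
    proof -
      have c: "continuous_on {a..b} (\<psi> n)"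
        unfolding \<psi>_def [abs_def] by (intro continuous_intros)
      have "(\<lambda>\<tau>. \<psi> n \<tau> * g \<tau>) absolutely_integrable_on {a..b}"
        using c by (intro absolutely_integrable_bounded_measurable_product_real g)
          (auto intro: continuous_imp_measurable_on_sets_lebesgue compact_imp_bounded
            compact_continuous_image)
      then show ?thesis
        by (simp add: absolutely_integrable_on_def mult.commute)
    qed
    have "(\<lambda>n. integral {a..b} (\<lambda>\<tau>. g \<tau> * \<psi> n \<tau>)) \<longlonglongrightarrow>
        integral {a..b} (\<lambda>\<tau>. g \<tau> * (indicat_real {s<..} \<tau> - indicat_real {t<..} \<tau>))"
    proof (rule dominated_convergence(2)[where h = "\<lambda>\<tau>. \<bar>g \<tau>\<bar>"])
      show "(\<lambda>\<tau>. \<bar>g \<tau>\<bar>) integrable_on {a..b}"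
        using g by (simp add: absolutely_integrable_on_def)
      have "\<bar>\<psi> n \<tau>\<bar> \<le> 1" for n \<tau>
        using smooth_step_bounds[of "real n * (\<tau> - s)"] smooth_step_bounds[of "real n * (\<tau> - t)"]
        by (auto simp: \<psi>_def)
      then show "norm (g \<tau> * \<psi> n \<tau>) \<le> \<bar>g \<tau>\<bar>" for n \<tau>
        by (simp add: abs_mult mult_left_le)
      show "(\<lambda>n. g \<tau> * \<psi> n \<tau>) \<longlonglongrightarrow> g \<tau> * (indicat_real {s<..} \<tau> - indicat_real {t<..} \<tau>)" for \<tau>
        unfolding \<psi>_def by (intro tendsto_intros smooth_step_scaled_tendsto)
    qed (rule \<psi>i)
    also have "integral {a..b} (\<lambda>\<tau>. g \<tau> * (indicat_real {s<..} \<tau> - indicat_real {t<..} \<tau>)) =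
        integral {a..b} (\<lambda>\<tau>. if \<tau> \<in> {s<..t} then g \<tau> else 0)"
      using st by (intro integral_cong) (auto simp: indicator_def)
    also have "\<dots> = integral {s<..t} g"
      using st by (subst integral_restrict_Int) (auto intro: arg_cong[where f = "\<lambda>S. integral S g"])
    also have "\<dots> = integral {s..t} g"
      by (intro integral_subset_negligible) (auto intro: negligible_subset[of "{s}"])
    finally have lim2: "(\<lambda>n. - integral {a..b} (\<lambda>\<tau>. g \<tau> * \<psi> n \<tau>)) \<longlonglongrightarrow> - integral {s..t} g"
      by (rule tendsto_minus)
    obtain N where N: "real N > 1 / (b - t)"
      using reals_Archimedean2 by blast
    \<comment> \<open>For \<open>n \<ge> N\<close> the second step is complete by
      \<open>t + 1/n \<le> d\<close>, so all these \<open>\<psi> n\<close> vanish outside one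
      compact interval \<open>{s..d}\<close> inside the open one.\<close>
    define d where "d = t + 1 / real N"
    have "real N > 0" using N st by (meson diff_gt_0_iff_gt less_trans zero_less_divide_1_iff)
    then have d: "d < b" using N st by (simp add: d_def field_simps)
    have "integral {a..b} (\<lambda>\<tau>. u \<tau> * D n \<tau>) = - integral {a..b} (\<lambda>\<tau>. g \<tau> * \<psi> n \<tau>)" if n: "n \<ge> N" for n
    proof (rule weak_derivative_test[OF w u g \<psi>D D _ st(1) d])
      have "\<psi> n \<tau> = 0" if "\<tau> < s" for \<tau>
        using that st by (simp add: \<psi>_def smooth_step_eq_0 mult_nonneg_nonpos)
      moreover have "\<psi> n \<tau> = 0" if "\<tau> > d" for \<tau>
      proof -
        have "1 \<le> real N * (\<tau> - t)"
          using that \<open>real N > 0\<close> by (simp add: d_def field_simps)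
        also have "\<dots> \<le> real n * (\<tau> - t)"
          using n less_trans[OF _ that, of t] \<open>real N > 0\<close>
          by (intro mult_right_mono) (simp_all add: d_def)
        finally have *: "1 \<le> real n * (\<tau> - t)" .
        moreover have "real n * (\<tau> - t) \<le> real n * (\<tau> - s)"
          using st by (intro mult_left_mono) auto
        ultimately show ?thesis by (simp add: \<psi>_def smooth_step_eq_1)
      qed
      ultimately show "{\<tau>. \<psi> n \<tau> \<noteq> 0} \<subseteq> {s..d}"
        by (auto simp: not_less [symmetric])
    qed
    then have "\<forall>\<^sub>F n in sequentially. integral {a..b} (\<lambda>\<tau>. u \<tau> * D n \<tau>) = - integral {a..b} (\<lambda>\<tau>. g \<tau> * \<psi> n \<tau>)"
      by (auto simp: eventually_sequentially)
    from Lim_transform_eventually[OF lim1 this]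
    have "u s - u t = - integral {s..t} g"
      using lim2 by (rule LIMSEQ_unique)
    then show ?thesis by simp
  qed
  have eq: "integral {s..t} g = u t - u s"
  proof (cases "s = t")
    case False
    then have "a < b" using st by simp
    \<comment> \<open>The interior case says that \<open>F\<close> is constant on the open interval;
      being continuous on its closure, it is constant there too.\<close>
    define F where "F \<tau> = u \<tau> - integral {a..\<tau>} g" for \<tau>
    have F: "continuous_on (closure {a<..<b}) F"
      unfolding F_def [abs_def] using \<open>a < b\<close>
      by (auto intro!: continuous_intros u indefinite_integral_continuous_1 gi)
    define c where "c = (a + b) / 2"
    have c: "a < c" "c < b" using \<open>a < b\<close> by (auto simp: c_def)
    have const: "F \<tau> = F c" if "\<tau> \<in> {a<..<b}" for \<tau>
    proof -
      have *: "F p = F q" if "a < p" "p < q" "q < b" for p q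
        using interior[OF that] Henstock_Kurzweil_Integration.integral_combine[of a p q g] that
          integrable_subinterval_real[OF gi, of a q]
        by (simp add: F_def)
      show ?thesis
        using *[of \<tau> c] *[of c \<tau>] that c
        by (metis greaterThanLessThan_iff linorder_less_linear)
    qed
    have "F s = F t"
      using continuous_constant_on_closure[OF F const] st \<open>a < b\<close> by simp
    then show ?thesis
      using Henstock_Kurzweil_Integration.integral_combine[of a s t g] st
        integrable_subinterval_real[OF gi, of a t]
      by (simp add: F_def)
  qed simp
  show ?thesis
    using eq st integrable_subinterval_real[OF gi, of s t] by (auto simp: has_integral_iff)
qed

section \<open>Comparison and Gronwall estimates\<close>

text \<open>Between the last point \<open>s\<close> with \<open>w s \<le> 0\<close> and
  \<open>t\<close> the function is positive, so the slope bound holds almost everywhere there and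
  can be integrated. Extending the integral of \<open>k\<close> back to \<open>a\<close> only
  increases it.\<close>

lemma le_integral_if_slope_bounded_where_positive:
  fixes w g k :: "real \<Rightarrow> real"
  assumes w: "continuous_on {a..b} w" "w a \<le> 0"
    and ftc: "\<And>s t. a \<le> s \<Longrightarrow> s \<le> t \<Longrightarrow> t \<le> b \<Longrightarrow> (g has_integral w t - w s) {s..t}"
    and k: "k integrable_on {a..b}" "\<And>t. 0 \<le> k t"
    and N: "negligible N" "\<And>t. t \<in> {a<..<b} - N \<Longrightarrow> w t > 0 \<Longrightarrow> g t \<le> k t"
    and t: "t \<in> {a..b}"
  shows "w t \<le> integral {a..t} k"
proof (cases "w t \<le> 0")
  case True
  have "0 \<le> integral {a..t} k"
    by (rule Henstock_Kurzweil_Integration.integral_nonneg)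
      (use k t in \<open>auto intro: integrable_subinterval_real\<close>)
  with True show ?thesis by linarith
next
  case False
  define S where "S = {s \<in> {a..t}. w s \<le> 0}"
  have "continuous_on {a..t} w" using w t by (auto intro: continuous_on_subset)
  then have "closed ({a..t} \<inter> w -` {..0})"
    by (intro continuous_closed_preimage) auto
  then have "compact ({a..t} \<inter> ({a..t} \<inter> w -` {..0}))"
    by (intro compact_Int_closed) auto
  also have "{a..t} \<inter> ({a..t} \<inter> w -` {..0}) = S"
    by (auto simp: S_def)
  finally have "compact S" .
  moreover have "S \<noteq> {}" using w t by (auto simp: S_def)
  ultimately obtain s where s: "s \<in> S" "\<And>r. r \<in> S \<Longrightarrow> r \<le> s"
    using compact_attains_sup by metis
  have s': "a \<le> s" "s \<le> t" "w s \<le> 0" using s by (auto simp: S_def)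
  have pos: "w r > 0" if "r \<in> {s<..t}" for r
    using s(2)[of r] s' that by (force simp: S_def)
  have g: "(g has_integral w t - w s) {s..t}" using ftc s' t by auto
  have ks: "k integrable_on {s..t}"
    using k(1) s' t by (auto intro: integrable_subinterval_real)
  \<comment> \<open>Replacing \<open>g\<close> by \<open>k\<close> on a negligible set keeps the
    integral and makes the bound hold at every point, including the ends, where positivity or the
    slope bound may fail.\<close>
  have "((\<lambda>\<tau>. if \<tau> \<in> N \<union> {s, t} then k \<tau> else g \<tau>) has_integral w t - w s) {s..t}"
    by (rule has_integral_spike[OF _ _ g, of "N \<union> {s, t}"]) (use N in auto)
  then have "w t - w s \<le> integral {s..t} k"
  proof (rule has_integral_le[OF _ integrable_integral[OF ks]])
    show "(if \<tau> \<in> N \<union> {s, t} then k \<tau> else g \<tau>) \<le> k \<tau>" if "\<tau> \<in> {s..t}" for \<tau>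
      using that N(2)[of \<tau>] pos[of \<tau>] s' t by auto
  qed
  also have "\<dots> \<le> integral {a..t} k"
    using k s' t by (intro integral_subset_le ks) (auto intro: integrable_subinterval_real)
  finally show ?thesis using s' by linarith
qed

text \<open>The hypothesis makes the derivative of the weighted primitive \<open>q\<close>
  nonpositive. As \<open>q\<close> starts at 0, the integral of \<open>h\<close> up to
  \<open>t\<close> is nonpositive, and the hypothesis at \<open>t\<close> then bounds
  \<open>h t\<close>.\<close>

lemma Gronwall_homogeneous:
  fixes h :: "real \<Rightarrow> real"
  assumes h: "continuous_on {a..b} h" and "C \<ge> 0"
    and le: "\<And>t. t \<in> {a..b} \<Longrightarrow> h t \<le> C * integral {a..t} h" and t: "t \<in> {a..b}"
  shows "h t \<le> 0"
proof -
  define q where "q \<tau> = exp (- C * \<tau>) * integral {a..\<tau>} h" for \<tau>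
  have q: "(q has_real_derivative exp (- C * \<tau>) * (h \<tau> - C * integral {a..\<tau>} h)) (at \<tau> within {a..t})"
    if "\<tau> \<in> {a..t}" for \<tau>
  proof -
    have "((\<lambda>\<tau>. integral {a..\<tau>} h) has_real_derivative h \<tau>) (at \<tau> within {a..t})"
      using that t by (intro integral_has_real_derivative continuous_on_subset[OF h]) auto
    then show ?thesis
      unfolding q_def [abs_def] by (auto intro!: derivative_eq_intros simp: algebra_simps)
  qed
  have "q t \<le> q a"
  proof (cases "a = t")
    case False
    then obtain z where z: "z \<in> {a<..<t}"
      "q t - q a = exp (- C * z) * (h z - C * integral {a..z} h) * (t - a)"
      using mvt_simple[of a t q "\<lambda>\<tau>. (*) (exp (- C * \<tau>) * (h \<tau> - C * integral {a..\<tau>} h))"] q t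
      by (auto simp: has_field_derivative_def)
    have "exp (- C * z) * (h z - C * integral {a..z} h) * (t - a) \<le> 0"
      using le[of z] z(1) t by (intro mult_nonpos_nonneg mult_nonneg_nonpos) auto
    with z(2) show ?thesis by linarith
  qed simp
  then have "integral {a..t} h \<le> 0"
    by (simp add: q_def mult_le_0_iff)
  then show ?thesis
    using le[OF t] mult_nonneg_nonpos[OF \<open>C \<ge> 0\<close>] by force
qed

section \<open>Monotonicity of the subdifferential and uniqueness\<close>

text \<open>Add the two subgradient inequalities, each tested at the other point.\<close>

lemma subdifferential_mono:
  fixes \<phi> :: "real \<Rightarrow> real"
  assumes "\<xi> \<in> subdifferential \<phi> v" "\<eta> \<in> subdifferential \<phi> w" "v > w"
  shows "\<xi> \<ge> \<eta>"
proof -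
  have "\<phi> v + \<xi> * (w - v) \<le> \<phi> w" "\<phi> w + \<eta> * (v - w) \<le> \<phi> v"
    using assms by (auto simp: subdifferential_def)
  then have "(\<eta> - \<xi>) * (v - w) \<le> 0" by (simp add: algebra_simps)
  then show ?thesis using assms(3) by (simp add: mult_le_0_iff)
qed

text \<open>The position and velocity differences each are bounded by an integral of the other, so
  Gronwall applies to the sum of their absolute values.\<close>

lemma strong_solution_unique:
  assumes 1: "strong_solution \<phi> f x0 v0 T x v" and 2: "strong_solution \<phi> f x0 v0 T y w"
    and L: "\<And>p q. \<bar>deriv f p - deriv f q\<bar> \<le> L * \<bar>p - q\<bar>" and t: "t \<in> {0..T}"
  shows "x t = y t \<and> v t = w t"
proof -
  obtain x' v' \<xi> where s1: "W12_deriv 0 T x x'" "W12_deriv 0 T v v'"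
      "AE t in lebesgue. t \<in> {0<..<T} \<longrightarrow> v t = x' t"
      "AE t in lebesgue. t \<in> {0<..<T} \<longrightarrow>
         \<xi> t \<in> subdifferential \<phi> (v t) \<and> v' t + 2 * v t + \<xi> t + deriv f (x t) = 0"
      "continuous_on {0..T} x" "continuous_on {0..T} v" "x 0 = x0" "v 0 = v0"
    using 1 unfolding strong_solution_def by auto
  obtain y' w' \<eta> where s2: "W12_deriv 0 T y y'" "W12_deriv 0 T w w'"
      "AE t in lebesgue. t \<in> {0<..<T} \<longrightarrow> w t = y' t"
      "AE t in lebesgue. t \<in> {0<..<T} \<longrightarrow>
         \<eta> t \<in> subdifferential \<phi> (w t) \<and> w' t + 2 * w t + \<eta> t + deriv f (y t) = 0"
      "continuous_on {0..T} y" "continuous_on {0..T} w" "y 0 = x0" "w 0 = v0"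
    using 2 unfolding strong_solution_def by auto
  \<comment> \<open>All almost-everywhere conditions of both solutions are bundled to obtain a
    single exceptional null set \<open>N\<close>.\<close>
  define Q where "Q t \<longleftrightarrow> v t = x' t \<and> w t = y' t \<and>
      \<xi> t \<in> subdifferential \<phi> (v t) \<and> v' t + 2 * v t + \<xi> t + deriv f (x t) = 0 \<and>
      \<eta> t \<in> subdifferential \<phi> (w t) \<and> w' t + 2 * w t + \<eta> t + deriv f (y t) = 0" for t
  have "AE t in lebesgue. t \<in> {0<..<T} \<longrightarrow> Q t"
    using s1(3,4) s2(3,4) unfolding Q_def by eventually_elim blast
  then obtain N where "N \<in> null_sets lebesgue" and Q: "\<And>t. t \<in> {0<..<T} - N \<Longrightarrow> Q t"
    by (rule AE_E3) auto
  note N = Q[unfolded Q_def]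
  have neg: "negligible N" by (simp add: \<open>N \<in> null_sets lebesgue\<close> negligible_iff_null_sets)
  define z where "z t = x t - y t" for t
  define u where "u t = v t - w t" for t
  note cont = s1(5,6) s2(5,6)
  have z: "continuous_on {0..T} z" "z 0 = 0" and u: "continuous_on {0..T} u" "u 0 = 0"
    using s1(7,8) s2(7,8) unfolding z_def [abs_def] u_def [abs_def]
    by (auto intro!: continuous_intros cont)
  have ftc: "(g has_integral p t - p s) {s..t}"
    if "W12_deriv 0 T p g" "continuous_on {0..T} p" "0 \<le> s" "s \<le> t" "t \<le> T" for p g s t
    using that by (intro weak_derivative_FTC) (auto simp: W12_deriv_def L2_on_imp_absolutely_integrable)
  have zftc: "((\<lambda>t. x' t - y' t) has_integral z t - z s) {s..t}"
    if "0 \<le> s" "s \<le> t" "t \<le> T" for s t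
    using has_integral_diff[OF ftc[OF s1(1) s1(5) that] ftc[OF s2(1) s2(5) that]]
    by (simp add: z_def algebra_simps)
  have uftc: "((\<lambda>t. v' t - w' t) has_integral u t - u s) {s..t}"
    if "0 \<le> s" "s \<le> t" "t \<le> T" for s t
    using has_integral_diff[OF ftc[OF s1(2) s1(6) that] ftc[OF s2(2) s2(6) that]]
    by (simp add: u_def algebra_simps)
  have "L \<ge> 0" using L[of 1 0] by simp
  \<comment> \<open>Applying the one-sided comparison to \<open>p\<close> and to \<open>- p\<close>
    gives a two-sided bound; it serves \<open>z\<close> with \<open>k = \<bar>u\<bar>\<close> and
    \<open>u\<close> with \<open>k = L * \<bar>z\<bar>\<close>.\<close>
  have both: "\<bar>p t\<bar> \<le> integral {0..t} k"
    if p: "continuous_on {0..T} p" "p 0 = 0"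
      and ftc: "\<And>s t. 0 \<le> s \<Longrightarrow> s \<le> t \<Longrightarrow> t \<le> T \<Longrightarrow> (g has_integral p t - p s) {s..t}"
      and k: "continuous_on {0..T} k" "\<And>t. 0 \<le> k t"
      and pos: "\<And>t. t \<in> {0<..<T} - N \<Longrightarrow> p t > 0 \<Longrightarrow> g t \<le> k t"
      and neg': "\<And>t. t \<in> {0<..<T} - N \<Longrightarrow> p t < 0 \<Longrightarrow> - g t \<le> k t"
      and t: "t \<in> {0..T}" for p g k :: "real \<Rightarrow> real" and t
  proof -
    have "p t \<le> integral {0..t} k"
      using p by (intro le_integral_if_slope_bounded_where_positive[where w = p, OF _ _ ftc _ k(2) neg pos t])
        (auto intro: integrable_continuous_real k)
    moreover have "- p t \<le> integral {0..t} k"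
    proof (rule le_integral_if_slope_bounded_where_positive[where w = "\<lambda>t. - p t" and g = "\<lambda>t. - g t", OF _ _ _ _ k(2) neg _ t])
      show "((\<lambda>t. - g t) has_integral - p t - - p s) {s..t}" if "0 \<le> s" "s \<le> t" "t \<le> T" for s t
        using has_integral_neg[OF ftc[OF that]] by simp
    qed (use p neg' in \<open>auto intro: integrable_continuous_real k continuous_intros\<close>)
    ultimately show ?thesis by linarith
  qed
  have zle: "\<bar>z t\<bar> \<le> integral {0..t} (\<lambda>t. \<bar>u t\<bar>)" if "t \<in> {0..T}" for t
    by (rule both[where p = z, OF z zftc _ _ _ _ that])
      (use N in \<open>auto intro!: continuous_intros cont simp: u_def\<close>)
  have ule: "\<bar>u t\<bar> \<le> integral {0..t} (\<lambda>t. L * \<bar>z t\<bar>)" if "t \<in> {0..T}" for t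
  proof (rule both[where p = u, OF u uftc _ _ _ _ that])
    fix t assume t: "t \<in> {0<..<T} - N"
    note Nt = N[OF t] and Lt = L[of "x t" "y t", folded z_def]
    \<comment> \<open>Subtracting the equations leaves \<open>- 2 * u t\<close>, minus the
      difference of the subgradients, minus the difference of the \<open>deriv f\<close> terms.
      Where \<open>u t > 0\<close> the first two contributions are nonpositive.\<close>
    show "v' t - w' t \<le> L * \<bar>z t\<bar>" if "u t > 0"
      using subdifferential_mono[of "\<xi> t" \<phi> "v t" "\<eta> t" "w t"] Nt Lt that
      by (auto simp: u_def abs_le_iff)
    show "- (v' t - w' t) \<le> L * \<bar>z t\<bar>" if "u t < 0"
      using subdifferential_mono[of "\<eta> t" \<phi> "w t" "\<xi> t" "v t"] Nt Lt that
      by (auto simp: u_def abs_le_iff)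
  qed (use \<open>L \<ge> 0\<close> in \<open>auto intro!: continuous_intros z\<close>)
  have "\<bar>z t\<bar> + \<bar>u t\<bar> \<le> 0"
  proof (rule Gronwall_homogeneous[OF _ _ _ t])
    show "continuous_on {0..T} (\<lambda>t. \<bar>z t\<bar> + \<bar>u t\<bar>)"
      by (intro continuous_intros z u)
    show "L + 1 \<ge> 0" using \<open>L \<ge> 0\<close> by simp
    fix t assume t: "t \<in> {0..T}"
    have c: "continuous_on {0..t} z" "continuous_on {0..t} u"
      using z u t by (auto intro: continuous_on_subset)
    have "\<bar>z t\<bar> + \<bar>u t\<bar> \<le> integral {0..t} (\<lambda>t. \<bar>u t\<bar>) + integral {0..t} (\<lambda>t. L * \<bar>z t\<bar>)"
      using zle[OF t] ule[OF t] by linarith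
    also have "\<dots> = integral {0..t} (\<lambda>t. \<bar>u t\<bar> + L * \<bar>z t\<bar>)"
      by (intro Henstock_Kurzweil_Integration.integral_add [symmetric]
          integrable_continuous_real continuous_intros c)
    also have "\<dots> \<le> integral {0..t} (\<lambda>t. (L + 1) * (\<bar>z t\<bar> + \<bar>u t\<bar>))"
      using \<open>L \<ge> 0\<close>
      by (intro integral_le integrable_continuous_real continuous_intros c)
        (auto simp: algebra_simps)
    finally show "\<bar>z t\<bar> + \<bar>u t\<bar> \<le> (L + 1) * integral {0..t} (\<lambda>t. \<bar>z t\<bar> + \<bar>u t\<bar>)"
      by simp
  qed
  then have "z t = 0" "u t = 0" by linarith+
  then show ?thesis by (simp add: z_def u_def)
qed

section \<open>Classical functions as Sobolev functions\<close>

lemma L2_on_continuous: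
  assumes "continuous_on {a..b} u"
  shows "L2_on a b u"
proof -
  have *: "set_integrable lebesgue {a<..<b} p" if "continuous_on {a..b} p" for p :: "real \<Rightarrow> real"
    using that by (intro set_integrable_subset[OF absolutely_integrable_continuous_real[of a b]]) auto
  show ?thesis
    unfolding L2_on_def
    using *[OF assms] *[of "\<lambda>t. (u t)\<^sup>2"] assms
    by (auto intro!: continuous_intros borel_measurable_integrable
        simp: set_integrable_def set_borel_measurable_def)
qed

text \<open>Integration by parts, with no boundary terms because the support of a test function
  stays inside the open interval.\<close>

lemma W12_deriv_C1:
  assumes u: "\<And>t. (u has_real_derivative g t) (at t)" and g: "continuous_on UNIV g"
  shows "W12_deriv a b u g"
proof -
  have uc: "continuous_on S u" for S
    using u by (meson DERIV_isCont continuous_at_imp_continuous_on)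
  have gc: "continuous_on S g" for S
    using g continuous_on_subset by blast
  have "(LINT t:{a<..<b}|lebesgue. u t * deriv \<psi> t) = - (LINT t:{a<..<b}|lebesgue. g t * \<psi> t)"
    if \<psi>: "test_function a b \<psi>" for \<psi>
  proof (cases "a < b")
    case True
    obtain D where D: "\<And>t. (\<psi> has_real_derivative D t) (at t)" "continuous_on UNIV D"
      using \<psi> unfolding test_function_def C1_differentiable_on_def
      by (auto simp: has_real_derivative_iff_has_vector_derivative)
    have Dc: "continuous_on S D" for S
      using D(2) continuous_on_subset by blast
    have \<psi>c: "continuous_on S \<psi>" for S
      using D(1) by (meson DERIV_isCont continuous_at_imp_continuous_on)
    have "deriv \<psi> = D"
      using D DERIV_imp_deriv by blast
    have int: "set_integrable lebesgue {a<..<b} p" if "continuous_on {a..b} p" for p :: "real \<Rightarrow> real"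
      using that by (intro set_integrable_subset[OF absolutely_integrable_continuous_real[of a b]]) auto
    have "\<psi> a = 0" "\<psi> b = 0"
      using \<psi> closure_subset[of "{t. \<psi> t \<noteq> 0}"] by (auto simp: test_function_def)
    moreover have "((\<lambda>t. u t * D t + g t * \<psi> t) has_integral u b * \<psi> b - u a * \<psi> a) {a..b}"
    proof (rule fundamental_theorem_of_calculus)
      show "((\<lambda>t. u t * \<psi> t) has_vector_derivative u t * D t + g t * \<psi> t) (at t within {a..b})" for t
        using DERIV_mult'[OF u D(1)] has_field_derivative_at_within
        by (metis has_real_derivative_iff_has_vector_derivative)
    qed (use True in simp)
    moreover have "integral {a..b} (\<lambda>t. u t * D t + g t * \<psi> t) =
        integral {a..b} (\<lambda>t. u t * D t) + integral {a..b} (\<lambda>t. g t * \<psi> t)"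
      by (intro Henstock_Kurzweil_Integration.integral_add integrable_continuous_real
          continuous_intros uc Dc gc \<psi>c)
    ultimately have "integral {a..b} (\<lambda>t. u t * D t) = - integral {a..b} (\<lambda>t. g t * \<psi> t)"
      by (simp add: has_integral_iff)
    moreover have "set_integrable lebesgue {a<..<b} (\<lambda>t. u t * D t)"
      "set_integrable lebesgue {a<..<b} (\<lambda>t. g t * \<psi> t)"
      by (intro int continuous_intros uc Dc gc \<psi>c)+
    ultimately show ?thesis
      using \<open>deriv \<psi> = D\<close>
      by (simp add: set_lebesgue_integral_eq_integral integral_open_interval_real)
  qed (simp add: set_lebesgue_integral_def)
  then show ?thesis
    by (simp add: W12_deriv_def weak_derivative_def L2_on_continuous uc gc)
qed

section \<open>The subdifferential of dry friction\<close>

text \<open>Testing at 1 and -1 yields the two bounds; conversely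
  \<open>\<xi> * w \<le> \<bar>\<xi>\<bar> * \<bar>w\<bar>\<close>.\<close>

lemma subdifferential_abs_0:
  assumes "r \<ge> 0"
  shows "subdifferential (\<lambda>v::real. r * \<bar>v\<bar>) 0 = {- r..r}"
proof (intro equalityI subsetI)
  fix \<xi> assume "\<xi> \<in> subdifferential (\<lambda>v. r * \<bar>v\<bar>) 0"
  then have "\<xi> * w \<le> r * \<bar>w\<bar>" for w
    by (simp add: subdifferential_def)
  from this[of 1] this[of "-1"] show "\<xi> \<in> {- r..r}" by simp
next
  fix \<xi> assume "\<xi> \<in> {- r..r}"
  then have "\<xi> * w \<le> r * \<bar>w\<bar>" for w
    using mult_right_mono[of "\<bar>\<xi>\<bar>" r "\<bar>w\<bar>"] abs_ge_self[of "\<xi> * w"] by (fastforce simp: abs_mult abs_le_iff)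
  then show "\<xi> \<in> subdifferential (\<lambda>v. r * \<bar>v\<bar>) 0"
    by (simp add: subdifferential_def)
qed

lemma subdifferential_abs_pos:
  assumes "r \<ge> 0" "v > 0"
  shows "r \<in> subdifferential (\<lambda>v::real. r * \<bar>v\<bar>) v"
  using assms mult_left_mono[OF abs_ge_self, of r] by (simp add: subdifferential_def algebra_simps)

section \<open>The explicit solution that never stops\<close>

theorem proposition2p14:
  fixes r A :: real and \<phi> f X V :: "real \<Rightarrow> real"
  assumes "r > 0" and "A > 0"
    and "\<phi> = (\<lambda>v. r * \<bar>v\<bar>)" and "f = (\<lambda>x. 1 / 2 * x\<^sup>2)"
    and "X = (\<lambda>t. - r - A * exp (- t))" and "V = (\<lambda>t. A * exp (- t))"
  shows "global_strong_solution \<phi> f (- r - A) A X V \<and>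
    (\<forall>x v. global_strong_solution \<phi> f (- r - A) A x v \<longrightarrow> (\<forall>t\<ge>0. x t = X t \<and> v t = V t)) \<and>
    (\<forall>t\<ge>0. (X has_real_derivative V t) (at t within {0..})) \<and>
    (X \<longlongrightarrow> - r) at_top \<and>
    subdifferential \<phi> 0 = {- r..r} \<and>
    - deriv f (- r) \<in> subdifferential \<phi> 0 \<and>
    - deriv f (- r) \<in> frontier (subdifferential \<phi> 0) \<and>
    \<not> (\<exists>T\<ge>0. \<forall>t\<ge>T. V t = 0)"
proof -
  have f': "deriv f x = x" for x
    unfolding assms by (rule DERIV_imp_deriv) (auto intro!: derivative_eq_intros)
  have X': "(X has_real_derivative V t) (at t)" and V': "(V has_real_derivative - V t) (at t)" for t
    unfolding assms by (auto intro!: derivative_eq_intros)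
  have cont: "continuous_on S X" "continuous_on S V" for S
    unfolding assms by (intro continuous_intros)+
  have sol: "global_strong_solution \<phi> f (- r - A) A X V"
    unfolding global_strong_solution_def strong_solution_def
  proof (intro allI impI conjI)
    fix T :: real
    have "W12_deriv 0 T X V" "W12_deriv 0 T V (\<lambda>t. - V t)" "L2_on 0 T (\<lambda>t. r)"
      by (intro W12_deriv_C1 X' V' L2_on_continuous continuous_intros cont)+
    \<comment> \<open>Positive velocity fixes the friction at \<open>r\<close>, leaving the linear
      equation with double characteristic root -1. The chosen data satisfy
      \<open>X + V = - r\<close>, which removes the \<open>t * exp (- t)\<close> mode.\<close>
    moreover have "V t > 0" "- V t + 2 * V t + r + X t = 0" for t
      using assms by auto
    then have "AE t in lebesgue. t \<in> {0<..<T} \<longrightarrow> r \<in> subdifferential \<phi> (V t) \<and>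
        - V t + 2 * V t + r + deriv f (X t) = 0"
      using assms(1,3) by (auto simp: f' subdifferential_abs_pos)
    ultimately show "\<exists>x' v' \<xi>. W12_deriv 0 T X x' \<and> W12_deriv 0 T V v' \<and> L2_on 0 T \<xi> \<and>
        (AE t in lebesgue. t \<in> {0<..<T} \<longrightarrow> V t = x' t) \<and>
        (AE t in lebesgue. t \<in> {0<..<T} \<longrightarrow>
           \<xi> t \<in> subdifferential \<phi> (V t) \<and> v' t + 2 * V t + \<xi> t + deriv f (X t) = 0)"
      by (intro exI[of _ V] exI[of _ "\<lambda>t. - V t"] exI[of _ "\<lambda>t. r"]) auto
  qed (use assms(5,6) cont in auto)
  have uniq: "x t = X t \<and> v t = V t"
    if "global_strong_solution \<phi> f (- r - A) A x v" "t \<ge> 0" for x v t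
  proof -
    \<comment> \<open>The horizon \<open>t + 1\<close> is positive even for \<open>t = 0\<close>, as
      the global notion demands.\<close>
    have "strong_solution \<phi> f (- r - A) A (t + 1) x v" "strong_solution \<phi> f (- r - A) A (t + 1) X V"
      using that sol by (auto simp: global_strong_solution_def)
    moreover have "\<bar>deriv f p - deriv f q\<bar> \<le> 1 * \<bar>p - q\<bar>" for p q
      by (simp add: f')
    ultimately show ?thesis
      using that(2) by (intro strong_solution_unique[where x = x and y = X and v = v and w = V and t = t and L = 1])
        auto
  qed
  have "((\<lambda>t. exp (- t :: real)) \<longlongrightarrow> 0) at_top"
    by (rule filterlim_compose[OF exp_at_bot filterlim_uminus_at_bot_at_top])
  from tendsto_diff[OF tendsto_const tendsto_mult_left[OF this], of "- r" A]
  have lim: "(X \<longlongrightarrow> - r) at_top"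
    by (simp add: assms(5))
  have sub: "subdifferential \<phi> 0 = {- r..r}"
    using assms by (simp add: subdifferential_abs_0)
  have "V t \<noteq> 0" for t using assms by simp
  then have "\<not> (\<exists>T\<ge>0. \<forall>t\<ge>T. V t = 0)" by blast
  moreover have "\<forall>t\<ge>0. (X has_real_derivative V t) (at t within {0..})"
    using X' has_field_derivative_at_within by blast
  \<comment> \<open>The value is \<open>r\<close>, the right endpoint of the interval.\<close>
  moreover have "- deriv f (- r) \<in> {- r..r} \<and> - deriv f (- r) \<in> frontier {- r..r}"
    using \<open>r > 0\<close> by (simp add: f' frontier_def)
  ultimately show ?thesis
    unfolding sub using sol uniq lim by blast
qed

end
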